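(* Let $g:\mathbb{R}^n\to\mathbb{R}^n$, let $f(x):=g(x)-x$, and set $\nu:=\inf_{x\in\mathbb{R}^n}\|f(x)\|$. Suppose that (i) $\|f(g(x))\|\le\|f(x)\|$ for all $x\in\mathbb{R}^n$; (ii) $\lim_{k\to\infty}\|f(g^{[k]}(x))\|=\nu$ for all $x\in\mathbb{R}^n$, where $g^{[k]}:=g\circ\cdots\circ g$ ($k$ times). Let $\{x^k\}$ be generated by the regularized Anderson acceleration algorithm (LM-AA, described in the context) with stopping threshold $\epsilon_f=0$, and let $f^k:=f(x^k)$. Then $$\lim_{k\to\infty}\|f^k\|=\nu,$$ where, if the algorithm terminates at some iteration $K$, this is understood as $\|f^K\|=\nu$.
   Context: $\|\cdot\|$ is the Euclidean norm on $\mathbb{R}^n$. LM-AA algorithm. Input: a mapping $g:\mathbb{R}^n\to\mathbb{R}^n$ with residual $f(x)=g(x)-x$; a starting point $x^0\in\mathbb{R}^n$; a memory parameter $m\in\mathbb{N}$, $m\ge1$; constants $\mu_0>0$, $0<p_1<p_2<1$, $0<\eta_2<1<\eta_1$, $0<c<1$, $\gamma\in(0,\frac{1}{m+1})$. For $k=0,1,2,\dots$ perform the following steps. 1. Compute $g^k:=g(x^k)$ and $f^k:=f(x^k)=g^k-x^k$. With stopping threshold $\epsilon_f=0$: if $f^k=0$, terminate. 2. Let $m_k:=\min\{m,k\}$. Let $k_0$ be the largest index in $\{k,k-1,\dots,k-m_k\}$ at which $\|f^i\|$ is minimal over $i\in\{k,k-1,\dots,k-m_k\}$, and let $k_1,\dots,k_{m_k}$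 be an enumeration of the remaining indices of $\{k,\dots,k-m_k\}$. 3. For $\alpha\in\mathbb{R}^{m_k}$ define $\hat f^k(\alpha):=f^{k_0}+\sum_{i=1}^{m_k}\alpha_i(f^{k_i}-f^{k_0})$ and $\hat g^k(\alpha):=g^{k_0}+\sum_{i=1}^{m_k}\alpha_i(g^{k_i}-g^{k_0})$ (for $k=0$ the sums are empty). 4. Set $\lambda_k:=\mu_k\|f^{k_0}\|^2$ and let $\alpha^k:=\operatorname{argmin}_{\alpha\in\mathbb{R}^{m_k}}\|\hat f^k(\alpha)\|^2+\lambda_k\|\alpha\|^2$. 5. Set $r_k:=(1-m_k\gamma)\|f^{k_0}\|+\gamma\sum_{i=1}^{m_k}\|f^{k_i}\|$, $\mathrm{ared}_k:=r_k-\|f(\hat g^k(\alpha^k))\|$, $\mathrm{pred}_k:=r_k-c\|\hat f^k(\alpha^k)\|$, and $\rho_k:=\mathrm{ared}_k/\mathrm{pred}_k$. 6. Set $\mu_{k+1}:=\eta_1\mu_k$ if $\rho_k<p_1$; $\mu_{k+1}:=\mu_k$ if $\rho_k\in[p_1,p_2]$; $\mu_{k+1}:=\eta_2\mu_k$ if $\rho_k>p_2$. 7. If $\rho_k\ge p_1$ (successful iteration), set $x^{k+1}:=\hat g^k(\alpha^k)$; otherwise set $x^{k+1}:=g^{k_0}=g(x^{k_0})$. *)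

theory Defs
  imports "HOL-Analysis.Analysis"
begin

definition residual :: "('a::real_vector \<Rightarrow> 'a) \<Rightarrow> 'a \<Rightarrow> 'a" where
  "residual g x = g x - x"

definition mem_size :: "nat \<Rightarrow> nat \<Rightarrow> nat" where
  "mem_size m k = min m k"

definition window :: "nat \<Rightarrow> nat \<Rightarrow> nat set" where
  "window m k = {k - mem_size m k..k}"

text \<open>For a sequence \<open>F\<close> of residuals, \<open>enumerates_window F m k ix\<close> says that \<open>ix 0\<close> is the index
  usually written $k_0$ and that \<open>ix 1, \<dots>, ix (mem_size m k)\<close> enumerate the rest of the window.
  Values of \<open>ix\<close> beyond \<open>mem_size m k\<close> are irrelevant.\<close>

definition enumerates_window ::
  "(nat \<Rightarrow> 'a::real_normed_vector) \<Rightarrow> nat \<Rightarrow> nat \<Rightarrow> (nat \<Rightarrow> nat) \<Rightarrow> bool" where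
  "enumerates_window F m k ix \<longleftrightarrow>
     ix 0 = Max {i \<in> window m k. \<forall>j \<in> window m k. norm (F i) \<le> norm (F j)} \<and>
     bij_betw ix {1..mem_size m k} (window m k - {ix 0})"

definition mix ::
  "(nat \<Rightarrow> 'a::real_vector) \<Rightarrow> (nat \<Rightarrow> nat) \<Rightarrow> nat \<Rightarrow> (nat \<Rightarrow> real) \<Rightarrow> 'a" where
  "mix v ix d a = v (ix 0) + (\<Sum>i=1..d. a i *\<^sub>R (v (ix i) - v (ix 0)))"

text \<open>The dimension \<open>d\<close> of the coefficient vector varies with the iteration, so the space of real
  \<open>d\<close>-vectors is rendered as the extensional functions on \<open>{1..d}\<close>, with Euclidean norm \<open>L2_set\<close>.\<close>

definition coeff_space :: "nat \<Rightarrow> (nat \<Rightarrow> real) set" where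
  "coeff_space d = {1..d} \<rightarrow>\<^sub>E UNIV"

definition regularized_argmin ::
  "(nat \<Rightarrow> 'a::real_normed_vector) \<Rightarrow> (nat \<Rightarrow> nat) \<Rightarrow> nat \<Rightarrow> real \<Rightarrow> (nat \<Rightarrow> real) \<Rightarrow> bool" where
  "regularized_argmin F ix d lam a \<longleftrightarrow>
     is_arg_min (\<lambda>b. (norm (mix F ix d b))\<^sup>2 + lam * (L2_set b {1..d})\<^sup>2)
       (\<lambda>b. b \<in> coeff_space d) a"

definition ref_value ::
  "(nat \<Rightarrow> 'a::real_normed_vector) \<Rightarrow> (nat \<Rightarrow> nat) \<Rightarrow> nat \<Rightarrow> real \<Rightarrow> real" where
  "ref_value F ix d \<gamma> =
     (1 - real d * \<gamma>) * norm (F (ix 0)) + \<gamma> * (\<Sum>i=1..d. norm (F (ix i)))"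

definition lm_aa_step ::
  "('a::real_normed_vector \<Rightarrow> 'a) \<Rightarrow> nat \<Rightarrow> real \<Rightarrow> real \<Rightarrow> real \<Rightarrow> real \<Rightarrow> real \<Rightarrow> real \<Rightarrow>
   (nat \<Rightarrow> 'a) \<Rightarrow> (nat \<Rightarrow> real) \<Rightarrow> (nat \<Rightarrow> nat) \<Rightarrow> (nat \<Rightarrow> real) \<Rightarrow> nat \<Rightarrow> bool" where
  "lm_aa_step g m p\<^sub>1 p\<^sub>2 \<eta>\<^sub>1 \<eta>\<^sub>2 c \<gamma> x \<mu> ix a k \<longleftrightarrow>
    (let d = mem_size m k;
         F = (\<lambda>i. residual g (x i));
         G = (\<lambda>i. g (x i));
         lam = \<mu> k * (norm (F (ix 0)))\<^sup>2;
         r = ref_value F ix d \<gamma>;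
         ared = r - norm (residual g (mix G ix d a));
         pred = r - c * norm (mix F ix d a);
         \<rho> = ared / pred
     in enumerates_window F m k ix \<and>
        regularized_argmin F ix d lam a \<and>
        \<mu> (Suc k) = (if \<rho> < p\<^sub>1 then \<eta>\<^sub>1 * \<mu> k else if \<rho> \<le> p\<^sub>2 then \<mu> k else \<eta>\<^sub>2 * \<mu> k) \<and>
        x (Suc k) = (if \<rho> \<ge> p\<^sub>1 then mix G ix d a else G (ix 0)))"

definition terminates_at :: "('a::real_normed_vector \<Rightarrow> 'a) \<Rightarrow> (nat \<Rightarrow> 'a) \<Rightarrow> nat \<Rightarrow> bool" where
  "terminates_at g x K \<longleftrightarrow> residual g (x K) = 0 \<and> (\<forall>j<K. residual g (x j) \<noteq> 0)"

text \<open>A step is performed at iteration \<open>k\<close> only if the algorithm has not stopped at or before \<open>k\<close>.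
  If it stops at \<open>K\<close>, the generated iterates are \<open>x 0, \<dots>, x K\<close>, and later values of \<open>x\<close>
  are unconstrained.\<close>

definition lm_aa_generated ::
  "('a::real_normed_vector \<Rightarrow> 'a) \<Rightarrow> nat \<Rightarrow> real \<Rightarrow> real \<Rightarrow> real \<Rightarrow> real \<Rightarrow> real \<Rightarrow> real \<Rightarrow> real \<Rightarrow>
   'a \<Rightarrow> (nat \<Rightarrow> 'a) \<Rightarrow> bool" where
  "lm_aa_generated g m \<mu>\<^sub>0 p\<^sub>1 p\<^sub>2 \<eta>\<^sub>1 \<eta>\<^sub>2 c \<gamma> x\<^sub>0 x \<longleftrightarrow>
    (\<exists>\<mu> ix a. x 0 = x\<^sub>0 \<and> \<mu> 0 = \<mu>\<^sub>0 \<and>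
       (\<forall>k. (\<forall>j\<le>k. \<not> terminates_at g x j) \<longrightarrow>
            lm_aa_step g m p\<^sub>1 p\<^sub>2 \<eta>\<^sub>1 \<eta>\<^sub>2 c \<gamma> x \<mu> (ix k) (a k) k))"

end

theory Submission
  imports Defs
begin

text \<open>Let \<open>W k\<close> be the largest residual norm in the window at iteration \<open>k\<close>. A successful step brings
  the new residual below \<open>q * W k\<close> with \<open>q = 1 - p\<^sub>1 * (1 - c) < 1\<close>, and an unsuccessful one brings it
  below every residual of the window. Hence \<open>W\<close> is nonincreasing, and a success at \<open>k\<close> forces
  \<open>W (k + m + 1) \<le> q * W k\<close>. With infinitely many successes, \<open>W\<close> tends to \<open>0\<close>. With finitely many,
  the newest iterate is eventually always the best one of its window, so the tail is a Picard
  iteration.\<close>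

section \<open>Window maxima and their contraction\<close>

definition window_max :: "nat \<Rightarrow> (nat \<Rightarrow> real) \<Rightarrow> nat \<Rightarrow> real" where
  "window_max m F k = Max (F ` window m k)"

lemma finite_window [simp]: "finite (window m k)"
  by (simp add: window_def)

lemma self_in_window [simp]: "k \<in> window m k"
  by (simp add: window_def)

lemma window_Suc: "window m (Suc k) \<subseteq> insert (Suc k) (window m k)"
  by (auto simp: window_def mem_size_def)

lemma window_max_ge: "j \<in> window m k \<Longrightarrow> F j \<le> window_max m F k"
  by (simp add: window_max_def)

lemma window_max_le_iff: "window_max m F k \<le> b \<longleftrightarrow> (\<forall>j \<in> window m k. F j \<le> b)"
proof -
  have "window m k \<noteq> {}" using self_in_window by blast
  then show ?thesis by (simp add: window_max_def)
qed

text \<open>The algorithm enters only through the two alternatives in \<open>step\<close>. The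
  window maxima decrease to a limit \<open>L \<ge> 0\<close>, and the recurring contraction gives
  \<open>L \<le> q * L\<close>, which for \<open>q < 1\<close> leaves only
  \<open>L = 0\<close>.\<close>

lemma window_contraction_tendsto_zero:
  fixes F :: "nat \<Rightarrow> real"
  assumes nonneg: "\<And>k. 0 \<le> F k" and q: "q < 1"
    and step: "\<And>k. F (Suc k) \<le> q * window_max m F k \<or> (\<forall>j \<in> window m k. F (Suc k) \<le> F j)"
    and inf: "\<exists>\<^sub>\<infinity>k. F (Suc k) \<le> q * window_max m F k"
  shows "F \<longlonglongrightarrow> 0"
proof -
  let ?W = "window_max m F"
  have W_nonneg: "0 \<le> ?W k" for k
    using nonneg[of k] window_max_ge[of k m k F] by simp
  have "F (Suc k) \<le> ?W k" for k
    using step[of k]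
  proof
    assume "F (Suc k) \<le> q * ?W k"
    also have "\<dots> \<le> 1 * ?W k" using q W_nonneg[of k] by (intro mult_right_mono) auto
    finally show ?thesis by simp
  next
    assume "\<forall>j \<in> window m k. F (Suc k) \<le> F j"
    then have "F (Suc k) \<le> F k" by simp
    then show ?thesis using window_max_ge[of k m k F] by simp
  qed
  \<comment> \<open>By \<open>window_Suc\<close>, the next window holds only old indices and
    \<open>Suc k\<close>, so no larger value can enter.\<close>
  then have "?W (Suc k) \<le> ?W k" for k
    using window_Suc[of m k] window_max_ge[of _ m k F] by (auto simp: window_max_le_iff)
  then have dec: "decseq ?W" by (simp add: decseq_Suc_iff)
  \<comment> \<open>The shift \<open>Suc m\<close> is the least that pushes \<open>k\<close> itself
    out of the window: the window at \<open>k + Suc m\<close> is exactly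
    \<open>{Suc k..k + Suc m}\<close>.\<close>
  have contract: "?W (k + Suc m) \<le> q * ?W k" if k: "F (Suc k) \<le> q * ?W k" for k
  proof -
    \<comment> \<open>A negative \<open>q\<close> together with
      \<open>0 \<le> F (Suc k) \<le> q * ?W k\<close> forces \<open>?W k = 0\<close>. In both cases
      multiplication by \<open>q\<close> preserves the needed inequality.\<close>
    have q_nonneg: "0 \<le> q \<or> ?W k = 0"
      using k nonneg[of "Suc k"] W_nonneg[of k]
      by (meson dual_order.trans linorder_not_less mult_neg_pos order_le_less)
    \<comment> \<open>The bound survives all later steps: a further contraction starts from a
      smaller maximum, and any other step stays below its predecessor.\<close>
    have *: "F (k + Suc j) \<le> q * ?W k" for j
    proof (induction j)
      case (Suc j)
      have W: "q * ?W (k + Suc j) \<le> q * ?W k"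
        using q_nonneg
      proof
        assume "0 \<le> q"
        then show ?thesis using decseqD[OF dec, of k "k + Suc j"] by (intro mult_left_mono) auto
      next
        assume "?W k = 0"
        then show ?thesis
          using decseqD[OF dec, of k "k + Suc j"] W_nonneg[of "k + Suc j"] by simp
      qed
      show ?case
        using step[of "k + Suc j"]
      proof
        assume "F (Suc (k + Suc j)) \<le> q * ?W (k + Suc j)"
        with W show ?thesis by simp
      next
        assume "\<forall>i \<in> window m (k + Suc j). F (Suc (k + Suc j)) \<le> F i"
        then have "F (Suc (k + Suc j)) \<le> F (k + Suc j)" by simp
        with Suc show ?thesis by simp
      qed
    qed (use k in simp)
    have "F i \<le> q * ?W k" if "i \<in> window m (k + Suc m)" for i
    proof -
      have "k + Suc (i - Suc k) = i" using that by (auto simp: window_def mem_size_def)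
      then show ?thesis using *[of "i - Suc k"] by simp
    qed
    then show ?thesis by (simp add: window_max_le_iff)
  qed
  obtain L where L: "?W \<longlonglongrightarrow> L" "\<And>k. L \<le> ?W k"
    using decseq_convergent[OF dec] W_nonneg by metis
  have lim: "(\<lambda>k. q * ?W k - ?W (k + Suc m)) \<longlonglongrightarrow> q * L - L"
    by (intro tendsto_intros L LIMSEQ_ignore_initial_segment)
  have freq: "\<exists>\<^sub>Fk in sequentially. 0 \<le> q * ?W k - ?W (k + Suc m)"
    using inf contract unfolding cofinite_eq_sequentially[symmetric]
    by (auto elim!: frequently_elim1)
  \<comment> \<open>The inequality holds only for infinitely many \<open>k\<close>, but a negative
    limit would violate it for all large \<open>k\<close>.\<close>
  have "0 \<le> q * L - L"
  proof (rule ccontr)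
    assume "\<not> 0 \<le> q * L - L"
    then have "\<forall>\<^sub>F k in sequentially. q * ?W k - ?W (k + Suc m) < 0"
      by (intro order_tendstoD(2)[OF lim]) simp
    then show False using freq by (simp add: frequently_def not_le)
  qed
  then have "(1 - q) * L \<le> 0" by (simp add: algebra_simps)
  then have "L \<le> 0" using q by (simp add: mult_le_0_iff)
  moreover have "0 \<le> L" using L(1) W_nonneg by (simp add: LIMSEQ_le_const)
  ultimately have "?W \<longlonglongrightarrow> 0" using L(1) by simp
  then show ?thesis
    by (rule tendsto_sandwich[rotated 3, OF _ ])
       (auto intro!: always_eventually nonneg window_max_ge)
qed

section \<open>The best index, the regularized subproblem and the reference value\<close>

lemma enumerates_window_least:
  assumes "enumerates_window F m k ix"
  shows "ix 0 \<in> window m k" and "j \<in> window m k \<Longrightarrow> norm (F (ix 0)) \<le> norm (F j)"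
proof -
  let ?A = "{i \<in> window m k. \<forall>j \<in> window m k. norm (F i) \<le> norm (F j)}"
  obtain i where "is_arg_min (\<lambda>i. norm (F i)) (\<lambda>i. i \<in> window m k) i"
    using ex_is_arg_min_if_finite[of "window m k"] self_in_window[of k m] by fastforce
  then have "i \<in> ?A" by (auto simp: is_arg_min_linorder)
  \<comment> \<open>\<open>Max\<close> is meaningful only on a nonempty finite set; the minimizer
    \<open>i\<close> just found provides nonemptiness.\<close>
  then have "Max ?A \<in> ?A" by (intro Max_in) auto
  then show "ix 0 \<in> window m k" "j \<in> window m k \<Longrightarrow> norm (F (ix 0)) \<le> norm (F j)"
    using assms by (auto simp: enumerates_window_def)
qed

text \<open>Ties are broken towards the largest index, so a newest iterate that merely equals the
  best one is still chosen. The Picard tail depends on this.\<close>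

lemma enumerates_window_newest:
  assumes "enumerates_window F m k ix"
    and "\<And>j. j \<in> window m k \<Longrightarrow> norm (F k) \<le> norm (F j)"
  shows "ix 0 = k"
proof -
  have "ix 0 = Max {i \<in> window m k. \<forall>j \<in> window m k. norm (F i) \<le> norm (F j)}"
    using assms(1) by (simp add: enumerates_window_def)
  also have "\<dots> = k" using assms(2) by (intro Max_eqI) (auto simp: window_def)
  finally show ?thesis .
qed

text \<open>The zero coefficient vector is a competitor with value
  \<open>(norm (F (ix 0)))^2\<close>, and the penalty of the minimizer is nonnegative.\<close>

lemma regularized_argmin_norm_le:
  assumes "regularized_argmin F ix d lam a" and "0 \<le> lam"
  shows "norm (mix F ix d a) \<le> norm (F (ix 0))"
proof -
  \<comment> \<open>Members of \<open>coeff_space d\<close> must be \<open>undefined\<close> outside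
    \<open>{1..d}\<close>, hence the \<open>restrict\<close>.\<close>
  let ?z = "restrict (\<lambda>_. 0) {1..d} :: nat \<Rightarrow> real"
  have "?z \<in> coeff_space d" by (simp add: coeff_space_def)
  then have "(norm (mix F ix d a))\<^sup>2 + lam * (L2_set a {1..d})\<^sup>2
      \<le> (norm (mix F ix d ?z))\<^sup>2 + lam * (L2_set ?z {1..d})\<^sup>2"
    using assms(1) by (simp add: regularized_argmin_def is_arg_min_linorder)
  also have "\<dots> = (norm (F (ix 0)))\<^sup>2" by (simp add: mix_def L2_set_def)
  finally have "(norm (mix F ix d a))\<^sup>2 \<le> (norm (F (ix 0)))\<^sup>2"
    using assms(2) by (smt (verit) mult_nonneg_nonneg zero_le_power2)
  then show ?thesis by simp
qed

text \<open>The reference value is a convex combination of residual norms from the window, so it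
  lies between their minimum and their maximum.\<close>

lemma ref_value_bounds:
  assumes "enumerates_window F m k ix" and "0 \<le> \<gamma>" and "real (mem_size m k) * \<gamma> \<le> 1"
  shows "norm (F (ix 0)) \<le> ref_value F ix (mem_size m k) \<gamma>"
    and "ref_value F ix (mem_size m k) \<gamma> \<le> window_max m (\<lambda>i. norm (F i)) k"
proof -
  let ?d = "mem_size m k" and ?W = "window_max m (\<lambda>i. norm (F i)) k"
  have ix: "ix i \<in> window m k" if "i \<in> {1..?d}" for i
    using assms(1) that bij_betwE unfolding enumerates_window_def by blast
  have "(\<Sum>i=1..?d. norm (F (ix 0))) \<le> (\<Sum>i=1..?d. norm (F (ix i)))"
    by (intro sum_mono enumerates_window_least(2)[OF assms(1)] ix)
  then have "\<gamma> * (real ?d * norm (F (ix 0))) \<le> \<gamma> * (\<Sum>i=1..?d. norm (F (ix i)))"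
    using assms(2) by (intro mult_left_mono) simp_all
  then show "norm (F (ix 0)) \<le> ref_value F ix ?d \<gamma>"
    by (simp add: ref_value_def algebra_simps)
  have "(\<Sum>i=1..?d. norm (F (ix i))) \<le> (\<Sum>i=1..?d. ?W)"
    by (intro sum_mono window_max_ge[where F = "\<lambda>i. norm (F i)"] ix)
  then have "\<gamma> * (\<Sum>i=1..?d. norm (F (ix i))) \<le> \<gamma> * (real ?d * ?W)"
    using assms(2) by (intro mult_left_mono) simp_all
  moreover have "(1 - real ?d * \<gamma>) * norm (F (ix 0)) \<le> (1 - real ?d * \<gamma>) * ?W"
    using assms(3) window_max_ge[OF enumerates_window_least(1)[OF assms(1)], of "\<lambda>i. norm (F i)"]
    by (intro mult_left_mono) auto
  ultimately show "ref_value F ix ?d \<gamma> \<le> ?W"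
    by (simp add: ref_value_def algebra_simps)
qed

section \<open>Single steps of the algorithm and the Picard tail\<close>

lemma lm_aa_step_enumerates:
  "lm_aa_step g m p\<^sub>1 p\<^sub>2 \<eta>\<^sub>1 \<eta>\<^sub>2 c \<gamma> x \<mu> ix a k \<Longrightarrow>
    enumerates_window (\<lambda>i. residual g (x i)) m k ix"
  by (simp add: lm_aa_step_def Let_def)

lemma lm_aa_step_weight_pos:
  assumes "lm_aa_step g m p\<^sub>1 p\<^sub>2 \<eta>\<^sub>1 \<eta>\<^sub>2 c \<gamma> x \<mu> ix a k"
    and "0 < \<mu> k" and "0 < \<eta>\<^sub>1" and "0 < \<eta>\<^sub>2"
  shows "0 < \<mu> (Suc k)"
  using assms by (simp add: lm_aa_step_def Let_def)

text \<open>Acceptance means \<open>t \<le> r - p\<^sub>1 * (r - c * h)\<close>, where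
  \<open>h \<le> r\<close> by the argmin property. The right side is therefore at most
  \<open>(1 - p\<^sub>1 * (1 - c)) * r\<close>, and \<open>r\<close> is at most the window
  maximum.\<close>

lemma lm_aa_step_cases:
  assumes step: "lm_aa_step g m p\<^sub>1 p\<^sub>2 \<eta>\<^sub>1 \<eta>\<^sub>2 c \<gamma> x \<mu> ix a k"
    and nonzero: "\<And>j. j \<le> k \<Longrightarrow> residual g (x j) \<noteq> 0"
    and mu: "0 < \<mu> k" and p: "0 < p\<^sub>1" "p\<^sub>1 < 1" and c: "0 < c" "c < 1"
    and gam: "0 \<le> \<gamma>" "real (mem_size m k) * \<gamma> \<le> 1"
  obtains (success) "norm (residual g (x (Suc k)))
        \<le> (1 - p\<^sub>1 * (1 - c)) * window_max m (\<lambda>i. norm (residual g (x i))) k"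
    | (failure) "x (Suc k) = g (x (ix 0))"
proof -
  define F where "F = (\<lambda>i. residual g (x i))"
  define G where "G = (\<lambda>i. g (x i))"
  define d where "d = mem_size m k"
  define r where "r = ref_value F ix d \<gamma>"
  define h where "h = norm (mix F ix d a)"
  define t where "t = norm (residual g (mix G ix d a))"
  have en: "enumerates_window F m k ix"
    using lm_aa_step_enumerates[OF step] by (simp add: F_def)
  have "h \<le> norm (F (ix 0))"
    unfolding h_def
  proof (rule regularized_argmin_norm_le)
    show "regularized_argmin F ix d (\<mu> k * (norm (F (ix 0)))\<^sup>2) a"
      using step by (simp add: lm_aa_step_def Let_def F_def d_def)
  qed (use mu in simp)
  also have F0_le: "norm (F (ix 0)) \<le> r"
    using ref_value_bounds(1)[OF en gam] by (simp add: r_def d_def)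
  finally have "h \<le> r" .
  have "ix 0 \<le> k" using enumerates_window_least(1)[OF en] by (simp add: window_def)
  \<comment> \<open>Nontermination matters here: a nonzero best residual makes \<open>r\<close>, and
    then the denominator \<open>r - c * h\<close>, positive, so the ratio test can be multiplied
    out.\<close>
  with nonzero have "0 < r" using F0_le by (smt (verit) F_def norm_le_zero_iff)
  have "c * h \<le> c * r" using \<open>h \<le> r\<close> c by simp
  moreover have "c * r < r" using c \<open>0 < r\<close> by simp
  ultimately have pred_pos: "0 < r - c * h" by simp
  show ?thesis
  proof (cases "p\<^sub>1 \<le> (r - t) / (r - c * h)")
    case True
    then have x: "x (Suc k) = mix G ix d a"
      using step by (simp add: lm_aa_step_def Let_def F_def G_def d_def r_def h_def t_def)
    have "p\<^sub>1 * (r - c * h) \<le> r - t"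
      using True pred_pos by (simp add: pos_le_divide_eq)
    moreover have "p\<^sub>1 * (r - c * r) \<le> p\<^sub>1 * (r - c * h)"
      using \<open>c * h \<le> c * r\<close> p by simp
    ultimately have "t \<le> (1 - p\<^sub>1 * (1 - c)) * r" by (simp add: algebra_simps)
    also have "\<dots> \<le> (1 - p\<^sub>1 * (1 - c)) * window_max m (\<lambda>i. norm (F i)) k"
    proof (rule mult_left_mono)
      show "r \<le> window_max m (\<lambda>i. norm (F i)) k"
        using ref_value_bounds(2)[OF en gam] by (simp add: r_def d_def)
      show "0 \<le> 1 - p\<^sub>1 * (1 - c)" using p c mult_le_one[of p\<^sub>1 "1 - c"] by simp
    qed
    finally show ?thesis using success by (simp add: x F_def t_def)
  next
    case False
    then have "x (Suc k) = g (x (ix 0))"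
      using step by (simp add: lm_aa_step_def Let_def F_def G_def d_def r_def h_def t_def)
    then show ?thesis by (rule failure)
  qed
qed

text \<open>An unsuccessful step applies \<open>g\<close> to the best iterate of the window, so by
  \<open>nonexp\<close> the result is at least as good as the whole window and becomes the next best
  index. The orbit starts at \<open>Suc N\<close> because \<open>x N\<close> need not be the best of
  its own window.\<close>

lemma picard_tail:
  assumes en: "\<And>k. enumerates_window (\<lambda>i. residual g (x i)) m k (ix k)"
    and nonexp: "\<And>y. norm (residual g (g y)) \<le> norm (residual g y)"
    and tail: "\<And>k. N \<le> k \<Longrightarrow> x (Suc k) = g (x (ix k 0))"
  shows "x (Suc N + n) = (g ^^ n) (x (Suc N))"
proof (induction n)
  case (Suc n)
  let ?k = "N + n" and ?F = "\<lambda>i. residual g (x i)"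
  have "norm (?F (Suc ?k)) \<le> norm (?F j)" if "j \<in> window m (Suc ?k)" for j
  proof -
    have "norm (?F (Suc ?k)) \<le> norm (?F (ix ?k 0))"
      using nonexp by (simp add: tail)
    then show ?thesis
      using that window_Suc[of m ?k] enumerates_window_least(2)[OF en[of ?k]] by fastforce
  qed
  then have "ix (Suc ?k) 0 = Suc ?k" by (rule enumerates_window_newest[OF en])
  then show ?case using tail[of "Suc ?k"] Suc by simp
qed simp

theorem theorem1:
  fixes g :: "real ^ 'n \<Rightarrow> real ^ 'n"
    and m :: nat
    and \<mu>\<^sub>0 p\<^sub>1 p\<^sub>2 \<eta>\<^sub>1 \<eta>\<^sub>2 c \<gamma> \<nu> :: real
    and x\<^sub>0 :: "real ^ 'n"
    and x :: "nat \<Rightarrow> real ^ 'n"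
  assumes "m \<ge> 1" and "\<mu>\<^sub>0 > 0"
    and "0 < p\<^sub>1" and "p\<^sub>1 < p\<^sub>2" and "p\<^sub>2 < 1"
    and "0 < \<eta>\<^sub>2" and "\<eta>\<^sub>2 < 1" and "1 < \<eta>\<^sub>1"
    and "0 < c" and "c < 1"
    and "0 < \<gamma>" and "\<gamma> < 1 / (real m + 1)"
    and nu: "\<nu> = (INF y. norm (residual g y))"
    and nonexp: "\<And>y. norm (residual g (g y)) \<le> norm (residual g y)"
    and picard: "\<And>y. (\<lambda>k. norm (residual g ((g ^^ k) y))) \<longlonglongrightarrow> \<nu>"
    and gen: "lm_aa_generated g m \<mu>\<^sub>0 p\<^sub>1 p\<^sub>2 \<eta>\<^sub>1 \<eta>\<^sub>2 c \<gamma> x\<^sub>0 x"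
  shows "(\<forall>K. terminates_at g x K \<longrightarrow> norm (residual g (x K)) = \<nu>) \<and>
         ((\<forall>K. \<not> terminates_at g x K) \<longrightarrow> (\<lambda>k. norm (residual g (x k))) \<longlonglongrightarrow> \<nu>)"
proof (intro conjI allI impI)
  fix K
  assume "terminates_at g x K"
  then have zero: "residual g (x K) = 0" by (simp add: terminates_at_def)
  have "bdd_below (range (\<lambda>y. norm (residual g y)))" by (rule bdd_belowI[of _ 0]) auto
  then have "\<nu> \<le> norm (residual g (x K))" unfolding nu by (rule cINF_lower) simp
  moreover have "0 \<le> \<nu>" unfolding nu by (rule cINF_greatest) auto
  ultimately show "norm (residual g (x K)) = \<nu>" using zero by simp
next
  assume nonterm: "\<forall>K. \<not> terminates_at g x K"
  define F where "F = (\<lambda>k. norm (residual g (x k)))"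
  define q where "q = 1 - p\<^sub>1 * (1 - c)"
  \<comment> \<open>\<open>terminates_at\<close> singles out the first zero residual, so strong
    induction is needed to exclude every zero.\<close>
  have nonzero: "residual g (x k) \<noteq> 0" for k
  proof (induction k rule: less_induct)
    case (less k)
    then show ?case using nonterm by (auto simp: terminates_at_def)
  qed
  obtain \<mu> ix a where "\<mu> 0 = \<mu>\<^sub>0"
    and step: "\<And>k. lm_aa_step g m p\<^sub>1 p\<^sub>2 \<eta>\<^sub>1 \<eta>\<^sub>2 c \<gamma> x \<mu> (ix k) (a k) k"
    using gen nonterm unfolding lm_aa_generated_def by blast
  have mu: "0 < \<mu> k" for k
  proof (induction k)
    case 0
    then show ?case using \<open>\<mu> 0 = \<mu>\<^sub>0\<close> \<open>\<mu>\<^sub>0 > 0\<close> by simp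
  next
    case (Suc k)
    then show ?case using lm_aa_step_weight_pos[OF step] \<open>0 < \<eta>\<^sub>2\<close> \<open>1 < \<eta>\<^sub>1\<close> by simp
  qed
  \<comment> \<open>This keeps the weight of the best residual in the reference value
    nonnegative.\<close>
  have gam: "real (mem_size m k) * \<gamma> \<le> 1" for k
  proof -
    have "real (mem_size m k) * \<gamma> \<le> (real m + 1) * \<gamma>"
      using \<open>0 < \<gamma>\<close> by (intro mult_right_mono) (auto simp: mem_size_def)
    also have "\<dots> \<le> 1" using \<open>\<gamma> < 1 / (real m + 1)\<close> by (simp add: field_simps)
    finally show ?thesis .
  qed
  have dichotomy: "F (Suc k) \<le> q * window_max m F k \<or> x (Suc k) = g (x (ix k 0))" for k
    using lm_aa_step_cases[OF step nonzero mu \<open>0 < p\<^sub>1\<close> _ \<open>0 < c\<close> \<open>c < 1\<close> _ gam]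
      \<open>p\<^sub>1 < p\<^sub>2\<close> \<open>p\<^sub>2 < 1\<close> \<open>0 < \<gamma>\<close> unfolding F_def q_def by (metis less_imp_le less_trans)
  have en: "enumerates_window (\<lambda>i. residual g (x i)) m k (ix k)" for k
    by (rule lm_aa_step_enumerates[OF step])
  show "(\<lambda>k. norm (residual g (x k))) \<longlonglongrightarrow> \<nu>"
  \<comment> \<open>The split is on the contraction inequality, not on acceptance: wherever the
    inequality fails, \<open>dichotomy\<close> yields a Picard step.\<close>
  proof (cases "\<exists>\<^sub>\<infinity>k. F (Suc k) \<le> q * window_max m F k")
    case True
    have "F \<longlonglongrightarrow> 0"
    proof (rule window_contraction_tendsto_zero)
      show "q < 1" using \<open>0 < p\<^sub>1\<close> \<open>c < 1\<close> by (simp add: q_def)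
      show "F (Suc k) \<le> q * window_max m F k \<or> (\<forall>j \<in> window m k. F (Suc k) \<le> F j)" for k
        using dichotomy[of k] nonexp[of "x (ix k 0)"] enumerates_window_least(2)[OF en[of k]]
        unfolding F_def by force
    qed (use True in \<open>simp_all add: F_def\<close>)
    \<comment> \<open>The residuals tend to \<open>0\<close>, so it remains to see that
      \<open>\<nu>\<close> is \<open>0\<close>: it is a lower bound of the \<open>F k\<close> and an
      infimum of norms.\<close>
    moreover have "\<nu> \<le> F k" for k
      unfolding nu F_def by (rule cINF_lower) (auto intro: bdd_belowI[of _ 0])
    ultimately have "\<nu> \<le> 0" by (simp add: LIMSEQ_le_const)
    moreover have "0 \<le> \<nu>" unfolding nu by (rule cINF_greatest) auto
    ultimately show ?thesis using \<open>F \<longlonglongrightarrow> 0\<close> by (simp add: F_def)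
  next
    case False
    then obtain N where "\<And>k. N \<le> k \<Longrightarrow> \<not> F (Suc k) \<le> q * window_max m F k"
      by (auto simp: INFM_nat_le)
    then have "\<And>k. N \<le> k \<Longrightarrow> x (Suc k) = g (x (ix k 0))" using dichotomy by blast
    then have "x (Suc N + n) = (g ^^ n) (x (Suc N))" for n
      by (rule picard_tail[OF en nonexp])
    \<comment> \<open>The hypothesis \<open>picard\<close> holds for every starting point, in
      particular for \<open>x (Suc N)\<close>.\<close>
    then have "(\<lambda>n. norm (residual g (x (n + Suc N)))) \<longlonglongrightarrow> \<nu>"
      using picard[of "x (Suc N)"] by (simp add: add.commute)
    then show ?thesis by (rule LIMSEQ_offset)
  qed
qed

end
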